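(* For all sufficiently large positive integers $n$, $$ \#\left\{ S \subseteq \{1,2,\dots,n\} : \sum_{s \in S} \frac{1}{s} \leq 1 \right\} \leq 2^{0.93 n}.$$
   Context: The sum over the empty set is $0$. *)

theory Defs
  imports Complex_Main
begin

end

theory Submission
  imports Defs
begin

text \<open>
  By Chernoff's method with parameter \<open>t = n / 5\<close>, the number of these subsets is at most
  \<open>2 powr t * (\<Prod>k=1..n. 1 + 2 powr (- t / k))\<close>. Its logarithm to base 2, divided by \<open>n\<close>, tends to
  \<open>1/5\<close> plus the integral of \<open>log 2 (1 + 2 powr (- 1 / (5 * x)))\<close> over the unit interval, about
  0.9115. The integrand is increasing, so the right Riemann sum with 30 cells bounds the integral
  from above, and it is still small enough.
\<close>

text \<open>Each counted \<open>S\<close> has weight \<open>b powr (c - sum f S)\<close> at least 1.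
  Summed over all subsets of \<open>A\<close>, these weights factor into the product on the
  right.\<close>

lemma card_subsets_sum_le:
  fixes f :: "'a \<Rightarrow> real"
  assumes "finite A" "b \<ge> 1"
  shows "real (card {S. S \<subseteq> A \<and> sum f S \<le> c}) \<le> b powr c * (\<Prod>s\<in>A. 1 + b powr (- f s))"
proof -
  let ?F = "{S. S \<subseteq> A \<and> sum f S \<le> c}"
  have "real (card ?F) = (\<Sum>S\<in>?F. 1)"
    by simp
  also have "\<dots> \<le> (\<Sum>S\<in>?F. b powr (c - sum f S))"
    using assms by (intro sum_mono ge_one_powr_ge_zero) auto
  also have "\<dots> \<le> (\<Sum>S\<in>Pow A. b powr (c - sum f S))"
    using assms by (intro sum_mono2) auto
  also have "\<dots> = (\<Sum>S\<in>Pow A. b powr c * (\<Prod>s\<in>S. b powr (- f s)))"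
    using assms by (intro sum.cong) (auto simp: powr_add diff_conv_add_uminus
        powr_sum dest: finite_subset simp del: add_uminus_conv_diff simp flip: sum_negf)
  also have "\<dots> = b powr c * (\<Prod>s\<in>A. b powr (- f s) + 1)"
    using assms by (simp add: sum_distrib_left prod_add)
  finally show ?thesis by (simp add: add.commute)
qed

text \<open>All such \<open>k\<close> lie in the half-open interval from \<open>(i - 1) / r\<close>
  to \<open>i / r\<close>, whose length is \<open>1 / r\<close>.\<close>

lemma card_ceiling_fibre_le:
  fixes r :: real
  assumes "r > 0"
  shows "real (card {k \<in> A. \<lceil>real k * r\<rceil> = i}) \<le> 1 / r + 1"
proof (cases "{k \<in> A. \<lceil>real k * r\<rceil> = i} = {}")
  case True
  then show ?thesis using assms by (simp add: True)
next
  case False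
  let ?F = "{k \<in> A. \<lceil>real k * r\<rceil> = i}"
  have bnd: "real k \<le> i / r" "(i - 1) / r < real k" if "k \<in> ?F" for k
    using that assms by (auto simp: field_simps ceiling_eq_iff)
  have fin: "finite ?F"
  proof (rule finite_subset)
    show "?F \<subseteq> {..nat \<lfloor>i / r\<rfloor>}" using bnd by (auto simp: le_nat_floor)
  qed auto
  have "?F \<subseteq> {Min ?F..Max ?F}" using fin by auto
  then have "card ?F \<le> Suc (Max ?F) - Min ?F"
    using card_mono[of "{Min ?F..Max ?F}" ?F] by (simp only: card_atLeastAtMost finite_atLeastAtMost)
  \<comment> \<open>This keeps the natural subtraction from truncating, so it carries over to the
    reals.\<close>
  moreover have "Min ?F \<le> Max ?F" by (rule Min_le[OF fin Max_in[OF fin False]])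
  ultimately have "real (card ?F) \<le> real (Max ?F) - real (Min ?F) + 1" by linarith
  also have "\<dots> \<le> i / r - (i - 1) / r + 1"
    using bnd(1)[OF Max_in[OF fin False]] bnd(2)[OF Min_in[OF fin False]] by linarith
  also have "\<dots> = 1 / r + 1" using assms by (simp add: field_simps)
  finally show ?thesis .
qed

text \<open>Rounding \<open>k / n\<close> up to a multiple of \<open>1 / m\<close> can only increase
  \<open>f\<close>. Each of the \<open>m\<close> cells receives at most \<open>n / m + 1\<close>
  points, and as \<open>f\<close> is at least 1 there, every multiplicity may be raised to that
  common exponent.\<close>

lemma prod_le_Riemann_prod:
  fixes f :: "real \<Rightarrow> real" and m n :: nat
  assumes mono: "\<And>x y. 0 < x \<Longrightarrow> x \<le> y \<Longrightarrow> f x \<le> f y"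
    and ge1: "\<And>x. 0 < x \<Longrightarrow> 1 \<le> f x" and "m > 0" "n > 0"
  shows "(\<Prod>k=1..n. f (real k / real n)) \<le> (\<Prod>i=1..m. f (real i / real m)) powr (real n / real m + 1)"
proof -
  define c where "c k = nat \<lceil>real k * (real m / real n)\<rceil>" for k
  have int_c: "int (c k) = \<lceil>real k * (real m / real n)\<rceil>" for k
  proof -
    \<comment> \<open>An argument above -1 has a nonnegative ceiling, so \<open>nat\<close> loses
      nothing.\<close>
    have "- 1 < real k * (real m / real n)" by (rule less_le_trans[of _ 0]) auto
    then show ?thesis unfolding c_def by (simp del: times_divide_eq_right)
  qed
  have c_ge: "real k / real n \<le> real (c k) / real m" for k
  proof -
    have "real k * (real m / real n) \<le> real (c k)"
      unfolding c_def by (rule real_nat_ceiling_ge)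
    then show ?thesis using assms by (simp add: field_simps)
  qed
  have c_mem: "c k \<in> {1..m}" if "k \<in> {1..n}" for k
  proof -
    have "real k * (real m / real n) \<le> real m" "real k * (real m / real n) > 0"
      using that assms by (auto simp: field_simps)
    then have "\<lceil>real k * (real m / real n)\<rceil> \<le> int m" "\<lceil>real k * (real m / real n)\<rceil> > 0"
      by (simp_all add: ceiling_le_iff)
    then show ?thesis unfolding int_c[symmetric] by simp
  qed
  have fpos: "f (real i / real m) \<ge> 1" if "i \<in> {1..m}" for i
    using that assms by (intro ge1) auto
  have "(\<Prod>k=1..n. f (real k / real n)) \<le> (\<Prod>k=1..n. f (real (c k) / real m))"
    using assms c_ge by (intro prod_mono) (auto intro!: mono order.trans[OF _ ge1])
  also have "\<dots> = (\<Prod>i=1..m. \<Prod>k\<in>{k \<in> {1..n}. c k = i}. f (real (c k) / real m))"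
    using c_mem by (intro prod.group[symmetric]) auto
  also have "\<dots> = (\<Prod>i=1..m. f (real i / real m) ^ card {k \<in> {1..n}. c k = i})"
    by (intro prod.cong) auto
  also have "\<dots> \<le> (\<Prod>i=1..m. f (real i / real m) powr (real n / real m + 1))"
  proof (intro prod_mono conjI)
    fix i assume i: "i \<in> {1..m}"
    have "real (card {k \<in> {1..n}. c k = i}) \<le> real n / real m + 1"
      using card_ceiling_fibre_le[of "real m / real n" "{1..n}" "int i"] assms
      by (simp del: times_divide_eq_right flip: int_c)
    then show "f (real i / real m) ^ card {k \<in> {1..n}. c k = i} \<le> f (real i / real m) powr (real n / real m + 1)"
      using fpos[OF i] by (simp add: powr_mono flip: powr_realpow)
    show "0 \<le> f (real i / real m) ^ card {k \<in> {1..n}. c k = i}"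
      using fpos[OF i] by simp
  qed
  also have "\<dots> = (\<Prod>i=1..m. f (real i / real m)) powr (real n / real m + 1)"
    by (rule prod_powr_distrib[symmetric])
  finally show ?thesis .
qed

text \<open>The entry at index \<open>i - 1\<close> is the ceiling of \<open>1000 * 2 powr (- 6 / i)\<close>.\<close>
definition root_num :: "nat list" where
  "root_num = [16, 125, 250, 354, 436, 500, 553, 595, 630, 660, 686, 708, 727, 743, 758, 772, 783,
    794, 804, 813, 821, 828, 835, 841, 847, 853, 858, 862, 867, 871]"

text \<open>The base 2 logarithm of the product, divided by 30, is the right Riemann sum. The bound
  makes it at most 131/180, and adding 1/5 gives 167/180 < 0.93.\<close>

lemma Riemann_prod_le:
  "(\<Prod>i=1..30::nat. 1 + 2 powr (- (1 / 5) / (real i / 30))) \<le> 2 powr (131 / 6)"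
proof -
  let ?y = "\<lambda>i. real (root_num ! (i - 1)) / 1000"
  have idx: "{1..30::nat} = set [1, 2, 3, 4, 5, 6, 7, 8, 9, 10, 11, 12, 13, 14, 15, 16, 17, 18, 19, 20, 21, 22, 23, 24, 25, 26, 27, 28, 29, 30]"
    by (simp add: set_eq_iff) presburger
  \<comment> \<open>This is \<open>?y i ^ i \<ge> 1 / 64\<close> with denominators cleared, so that
    it can be evaluated in the natural numbers.\<close>
  have num: "\<forall>i\<in>{1..30}. 1000 ^ i \<le> 64 * (root_num ! (i - 1)) ^ i"
    unfolding idx by (simp add: root_num_def)
  have "(\<Prod>i=1..30::nat. 1 + 2 powr (- (1 / 5) / (real i / 30))) \<le> (\<Prod>i=1..30. 1 + ?y i)"
  proof (intro prod_mono conjI add_left_mono)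
    fix i :: nat assume i: "i \<in> {1..30}"
    show "0 \<le> 1 + (2::real) powr (- (1 / 5) / (real i / 30))" by (simp add: add_nonneg_nonneg)
    \<comment> \<open>The exponent is \<open>- 6 / i\<close>, so the \<open>i\<close>-th power
      removes the root.\<close>
    have "(2 powr (- (1 / 5) / (real i / 30))) ^ i = (2::real) powr (- 6)"
      using i by (simp add: powr_power)
    also have "\<dots> = 1 / 64" by (simp add: powr_minus)
    also have "\<dots> \<le> ?y i ^ i"
    proof -
      have "real (1000 ^ i) \<le> real (64 * (root_num ! (i - 1)) ^ i)"
        using num i of_nat_le_iff by blast
      then show ?thesis by (simp add: power_divide field_simps)
    qed
    finally show "2 powr (- (1 / 5) / (real i / 30)) \<le> ?y i"
      using i by (subst (asm) power_mono_iff) auto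
  qed
  also have "\<dots> = (\<Prod>i=1..30. real (1000 + root_num ! (i - 1)) / 1000)"
    by (intro prod.cong) (auto simp: field_simps)
  also have "\<dots> = real (\<Prod>i=1..30. 1000 + root_num ! (i - 1)) / 1000 ^ 30"
    by (simp only: prod_dividef of_nat_prod prod_constant card_atLeastAtMost) simp
  also have "(\<Prod>i=1..30. 1000 + root_num ! (i - 1)) \<le> 7 * 2 ^ 19 * 1000 ^ 30"
    unfolding idx by (simp add: prod.distinct_set_conv_list root_num_def)
  also have "real (7 * 2 ^ 19 * 1000 ^ 30) / 1000 ^ 30 = 7 * 2 ^ 19"
    by simp
  also have "\<dots> \<le> 2 powr (131 / 6)"
  proof (rule power_le_imp_le_base)
    \<comment> \<open>Sixth powers clear the denominator of 131/6; what remains is 7^6 = 117649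
      \<le> 131072 = 2^17.\<close>
    have "(7 * 2 ^ 19) ^ Suc 5 \<le> (2::real) ^ 131" by simp
    also have "\<dots> = (2 powr (131 / 6)) ^ Suc 5" by (simp add: powr_power del: power_Suc)
    finally show "(7 * 2 ^ 19) ^ Suc 5 \<le> ((2::real) powr (131 / 6)) ^ Suc 5" .
  qed simp
  finally show ?thesis by (simp add: divide_right_mono)
qed

theorem mainTheorem1:
  shows "\<forall>\<^sub>F n :: nat in sequentially.
    real (card {S. S \<subseteq> {1..n} \<and> (\<Sum>s\<in>S. 1 / real s) \<le> 1}) \<le> 2 powr (0.93 * real n)"
proof (rule eventually_sequentiallyI)
  \<comment> \<open>The margin 0.93 - 1/5 - 131/180 = 1/450, times \<open>n\<close>, must absorb the
    constant 131/6 that comes from the \<open>+ 1\<close> in the Riemann exponent. This holds from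
    9825 on, hence for all \<open>n\<close> considered here.\<close>
  fix n :: nat assume n: "n \<ge> 13200"
  define t where "t = real n / 5"
  let ?f = "\<lambda>x. 1 + 2 powr (- (1 / 5) / x) :: real"
  have "t > 0" using n by (simp add: t_def)
  moreover have "(\<Sum>s\<in>S. t / real s) = t * (\<Sum>s\<in>S. 1 / real s)" for S
    by (simp add: sum_distrib_left)
  ultimately have "{S. S \<subseteq> {1..n} \<and> (\<Sum>s\<in>S. 1 / real s) \<le> 1}
      = {S. S \<subseteq> {1..n} \<and> (\<Sum>s\<in>S. t / real s) \<le> t}"
    by simp
  then have "real (card {S. S \<subseteq> {1..n} \<and> (\<Sum>s\<in>S. 1 / real s) \<le> 1})
      \<le> 2 powr t * (\<Prod>k=1..n. 1 + 2 powr (- (t / real k)))"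
    using card_subsets_sum_le[of "{1..n}" 2 "\<lambda>s. t / real s" t] by simp
  \<comment> \<open>With \<open>t\<close> proportional to \<open>n\<close>, the factors depend only
    on \<open>k / n\<close>.\<close>
  also have "(\<Prod>k=1..n. 1 + 2 powr (- (t / real k))) = (\<Prod>k=1..n. ?f (real k / real n))"
    by (simp add: t_def)
  also have "\<dots> \<le> (\<Prod>i=1..30. ?f (real i / real 30)) powr (real n / real 30 + 1)"
    using n by (intro prod_le_Riemann_prod) (auto simp: frac_le)
  also have "\<dots> \<le> (2 powr (131 / 6)) powr (real n / real 30 + 1)"
    using Riemann_prod_le by (intro powr_mono2 prod_nonneg) (auto intro: add_nonneg_nonneg)
  also have "2 powr t * \<dots> = 2 powr (t + 131 / 6 * (real n / 30 + 1))"
    by (subst powr_add) (simp only: powr_powr of_nat_numeral)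
  also have "\<dots> \<le> 2 powr (0.93 * real n)"
    using n by (intro powr_mono) (auto simp: t_def)
  finally show "real (card {S. S \<subseteq> {1..n} \<and> (\<Sum>s\<in>S. 1 / real s) \<le> 1}) \<le> 2 powr (0.93 * real n)"
    by simp
qed

end
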